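(* Let $n \ge 3$ be an integer, let $p$ be a real number with $1 < p \le \frac{n+2}{n-2}$, and let $q = \frac{2p}{p+1}$. Then there exists a real number $M_2 > 0$ (depending on $n$ and $p$) such that, for every real $M > M_2$, every nonnegative solution $v$ on $\mathbb{R}^n$ of $$\Delta v + v^p + M|\nabla v|^q = 0 \quad \text{in } \mathbb{R}^n$$ satisfies $v \equiv 0$.
   Context: A solution is a global classical solution: a function $v \in C^2(\mathbb{R}^n)$ satisfying the equation at every point of $\mathbb{R}^n$. Nonnegative means $v(x) \ge 0$ for all $x$. No condition on the behaviour of $v$ at infinity is imposed. *)

theory Defs
  imports "HOL-Analysis.Analysis"
begin

definition partial_derivative :: "'n::finite \<Rightarrow> (real ^ 'n \<Rightarrow> real) \<Rightarrow> real ^ 'n \<Rightarrow> real" where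
  "partial_derivative i f x = frechet_derivative f (at x) (axis i 1)"

definition grad :: "(real ^ 'n::finite \<Rightarrow> real) \<Rightarrow> real ^ 'n \<Rightarrow> real ^ 'n" where
  "grad f x = (\<chi> i. partial_derivative i f x)"

definition laplacian :: "(real ^ 'n::finite \<Rightarrow> real) \<Rightarrow> real ^ 'n \<Rightarrow> real" where
  "laplacian f x = (\<Sum>i\<in>UNIV. partial_derivative i (partial_derivative i f) x)"

text \<open>The requirement of Frechet differentiability is essential here: \<^const>\<open>frechet_derivative\<close>
  is an arbitrary value at points where the function is not differentiable.\<close>

definition C1_function :: "(real ^ 'n::finite \<Rightarrow> real) \<Rightarrow> bool" where
  "C1_function f \<longleftrightarrow>
     (\<forall>x. f differentiable (at x)) \<and> (\<forall>i. continuous_on UNIV (partial_derivative i f))"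

definition C2_function :: "(real ^ 'n::finite \<Rightarrow> real) \<Rightarrow> bool" where
  "C2_function f \<longleftrightarrow> C1_function f \<and> (\<forall>i. C1_function (partial_derivative i f))"

end

theory Submission imports Defs begin

text \<open>
The proof is Bernstein's: a maximum principle for \<open>z = |\<nabla>v|\<^sup>2\<close>. Write \<open>n\<close> for the dimension. Bochner's
formula and the equation give
\<open>\<Delta>z = 2|D\<^sup>2v|\<^sup>2 + 2 \<nabla>v \<bullet> \<nabla>(\<Delta>v) = 2|D\<^sup>2v|\<^sup>2 - 2p v\<^sup>p\<^sup>-\<^sup>1 z - M q z\<^bsup>q/2-1\<^esup> \<nabla>v \<bullet> \<nabla>z\<close>,
and \<open>n |D\<^sup>2v|\<^sup>2 \<ge> (\<Delta>v)\<^sup>2 = (v\<^sup>p + M z\<^bsup>q/2\<^esup>)\<^sup>2\<close>. The only term of the wrong sign is \<open>v\<^sup>p\<^sup>-\<^sup>1 z\<close>. The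
exponent \<open>q = 2p/(p+1)\<close> is the one for which this term is homogeneous of degree two in the pair
\<open>(v\<^sup>p, z\<^bsup>q/2\<^esup>)\<close>, with the factor \<open>z\<^bsup>q/2\<^esup>\<close> to spare (\<open>powr_interpolation\<close>); so as soon as
\<open>M \<ge> n(p+1)\<close> the square absorbs it and
\<open>2 z\<^sup>q \<le> \<Delta>z + M q z\<^bsup>q/2-1\<^esup> \<nabla>v \<bullet> \<nabla>z\<close>.
The superlinear power \<open>z\<^sup>q\<close> yields a local bound in the manner of Keller and Osserman: on a ball of
radius \<open>R\<close> one compares \<open>z\<close> with a multiple of \<open>(R\<^sup>2 - |x-a|\<^sup>2)\<^sup>-\<^sup>k\<close>, \<open>k = 2/(q-1)\<close>, which is infinite on the
boundary, and obtains \<open>z a \<le> (B/R)\<^sup>k\<close> with \<open>B\<close> independent of \<open>R\<close> and of the centre \<open>a\<close>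
(\<open>gradient_estimate\<close>). Letting \<open>R\<close> tend to infinity, \<open>\<nabla>v = 0\<close> everywhere; then \<open>\<Delta>v = 0\<close>, and the
equation leaves \<open>v\<^sup>p = 0\<close>.

Bochner's formula involves third derivatives of \<open>v\<close>, and \<open>v\<close> is only of class \<open>C\<^sup>2\<close>. The maximum
principle does not need \<open>\<Delta>z\<close> itself, though: it is applied to \<open>z\<^sub>h = \<Sum>\<^sub>i (D\<^sub>i\<^sup>h v)\<^sup>2\<close>, with difference
quotients \<open>D\<^sub>i\<^sup>h\<close> in place of derivatives. This function is of class \<open>C\<^sup>2\<close>, with Laplacian
\<open>2 \<Sum>\<^sub>i\<^sub>j (D\<^sub>i\<^sup>h \<partial>\<^sub>jv)\<^sup>2 + 2 \<Sum>\<^sub>i D\<^sub>i\<^sup>h v D\<^sub>i\<^sup>h(\<Delta>v)\<close>. As \<open>h\<close> tends to 0 this converges locally uniformly, since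
by the equation \<open>\<Delta>v\<close> is of class \<open>C\<^sup>1\<close> where \<open>v\<close> and \<open>\<nabla>v\<close> do not vanish. The limit is the right-hand side of
Bochner's formula, and that is enough to compare \<open>z\<close> with a smooth function touching it from above
(\<open>touching_laplacian_le\<close>, \<open>bochner_touching\<close>).
\<close>

section \<open>Partial derivatives along coordinate lines\<close>

text \<open>In contrast to \<^const>\<open>partial_derivative\<close>, this predicate asserts that the derivative exists, and it
refers to one coordinate line only; the rules of one-variable calculus therefore carry over verbatim,
without total differentiability of the functions involved.\<close>

definition has_partial :: "'n::finite \<Rightarrow> (real ^ 'n \<Rightarrow> real) \<Rightarrow> real \<Rightarrow> real ^ 'n \<Rightarrow> bool" where
  "has_partial j f D x \<longleftrightarrow> ((\<lambda>t. f (x + t *\<^sub>R axis j 1)) has_real_derivative D) (at 0)"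

lemma has_partial_line:
  "((\<lambda>t. f (x + t *\<^sub>R axis j 1)) has_real_derivative D) (at s) \<longleftrightarrow>
   has_partial j f D (x + s *\<^sub>R axis j 1)"
proof -
  have "(\<lambda>t. f (x + (t + s) *\<^sub>R axis j 1)) = (\<lambda>t. f (x + s *\<^sub>R axis j 1 + t *\<^sub>R axis j 1))"
    by (simp add: algebra_simps)
  then show ?thesis
    using DERIV_shift[of "\<lambda>t. f (x + t *\<^sub>R axis j 1)" D 0 s]
    by (simp add: has_partial_def)
qed

lemma has_partial_partial_derivative:
  assumes "f differentiable (at x)"
  shows "has_partial j f (partial_derivative j f x) x"
proof -
  have "(f has_derivative frechet_derivative f (at x)) (at x)"
    using assms frechet_derivative_works by blast
  then have F: "(f has_derivative frechet_derivative f (at x)) (at (x + 0 *\<^sub>R axis j 1))"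
    by simp
  have "((\<lambda>t::real. x + t *\<^sub>R axis j 1) has_derivative (\<lambda>t. t *\<^sub>R axis j 1)) (at 0)"
    by (auto intro!: derivative_eq_intros)
  from has_derivative_compose[OF this F]
  have "((\<lambda>t. f (x + t *\<^sub>R axis j 1)) has_derivative
          (\<lambda>t. frechet_derivative f (at x) (t *\<^sub>R axis j 1))) (at 0)" .
  moreover have "frechet_derivative f (at x) (t *\<^sub>R axis j 1) = t * partial_derivative j f x" for t
    using linear_frechet_derivative[OF assms] by (simp add: linear_scale partial_derivative_def)
  ultimately show ?thesis
    by (simp add: has_partial_def has_field_derivative_def mult_commute_abs)
qed

lemma has_partial_const: "has_partial j (\<lambda>y. c) 0 x"
  by (simp add: has_partial_def)

lemma has_partial_nth: "has_partial j (\<lambda>y. (y - a) $ j) 1 x"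
  unfolding has_partial_def by (auto intro!: derivative_eq_intros simp: axis_def)

lemma has_partial_dist_square:
  "has_partial j (\<lambda>y. (y - a) \<bullet> (y - a)) (2 * (x - a) $ j) x"
proof -
  have "(x + t *\<^sub>R axis j 1 - a) \<bullet> (x + t *\<^sub>R axis j 1 - a)
        = (x - a) \<bullet> (x - a) + 2 * t * (x - a) $ j + t\<^sup>2" for t
  proof -
    have "x + t *\<^sub>R axis j 1 - a = (x - a) + t *\<^sub>R axis j 1" by simp
    then show ?thesis
      by (simp only: inner_add_left inner_add_right inner_scaleR_left inner_scaleR_right)
        (simp add: inner_axis inner_axis' power2_eq_square algebra_simps)
  qed
  then show ?thesis unfolding has_partial_def
    by (auto intro!: derivative_eq_intros)
qed

lemma has_partial_diff:
  "has_partial j f D x \<Longrightarrow> has_partial j g E x \<Longrightarrow> has_partial j (\<lambda>y. f y - g y) (D - E) x"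
  unfolding has_partial_def by (rule DERIV_diff)

lemma has_partial_mult:
  "has_partial j f D x \<Longrightarrow> has_partial j g E x \<Longrightarrow>
   has_partial j (\<lambda>y. f y * g y) (D * g x + E * f x) x"
  unfolding has_partial_def by (drule (1) DERIV_mult) simp

lemma has_partial_cmult:
  "has_partial j f D x \<Longrightarrow> has_partial j (\<lambda>y. c * f y) (c * D) x"
  unfolding has_partial_def by (rule DERIV_cmult)

lemma has_partial_sum:
  "(\<And>i. i \<in> A \<Longrightarrow> has_partial j (f i) (D i) x) \<Longrightarrow>
   has_partial j (\<lambda>y. \<Sum>i\<in>A. f i y) (\<Sum>i\<in>A. D i) x"
  unfolding has_partial_def by (rule DERIV_sum)

lemma has_partial_powr:
  assumes "has_partial j f D x" "f x > 0"
  shows "has_partial j (\<lambda>y. f y powr r) (r * f x powr (r - 1) * D) x"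
  using DERIV_fun_powr[of "\<lambda>t. f (x + t *\<^sub>R axis j 1)" D 0 r] assms
  unfolding has_partial_def by simp

section \<open>Necessary conditions at a maximum\<close>

lemma second_derivative_test:
  fixes f f' :: "real \<Rightarrow> real"
  assumes "d > 0"
    and f: "\<And>t. \<bar>t\<bar> < d \<Longrightarrow> (f has_real_derivative f' t) (at t)"
    and f': "(f' has_real_derivative l) (at 0)"
    and max: "\<And>t. \<bar>t\<bar> < d \<Longrightarrow> f t \<le> f 0"
  shows "l \<le> 0"
proof -
  have 0: "f' 0 = 0"
    using DERIV_local_max[of f "f' 0" 0 d] f[of 0] max \<open>d > 0\<close> by auto
  show "l \<le> 0"
  proof (rule ccontr)
    assume "\<not> l \<le> 0"
    then obtain e where e: "e > 0" "\<And>t. 0 < t \<Longrightarrow> t < e \<Longrightarrow> f' 0 < f' t"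
      using DERIV_pos_inc_right[OF f'] by auto
    define s where "s = min d e / 2"
    have s: "0 < s" "s < d" "s < e" using \<open>d > 0\<close> \<open>e > 0\<close> by (auto simp: s_def)
    have "\<exists>z>0. z < s \<and> f s - f 0 = (s - 0) * f' z"
      by (rule MVT2) (use s f in auto)
    then obtain z where "0 < z" "z < s" "f s - f 0 = s * f' z" by auto
    moreover have "f' z > 0" using e(2)[of z] 0 \<open>0 < z\<close> \<open>z < s\<close> s by auto
    ultimately have "f s > f 0" using s by (smt (verit) mult_pos_pos)
    then show False using max[of s] s by auto
  qed
qed

lemma line_in_open:
  fixes x :: "real ^ 'n::finite"
  assumes "open S" "x \<in> S"
  obtains d where "d > 0" "\<And>t. \<bar>t\<bar> < d \<Longrightarrow> x + t *\<^sub>R axis j 1 \<in> S"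
proof -
  obtain d where d: "d > 0" "ball x d \<subseteq> S" using assms openE by blast
  have "x + t *\<^sub>R axis j 1 \<in> S" if "\<bar>t\<bar> < d" for t
    using d that by (intro subsetD[OF d(2)]) (simp add: dist_norm norm_axis_1)
  then show ?thesis using d(1) that by blast
qed

lemma partial_eq_0_at_max:
  assumes "open S" "x \<in> S" "has_partial j w D x" "\<And>y. y \<in> S \<Longrightarrow> w y \<le> w x"
  shows "D = 0"
proof -
  obtain d where d: "d > 0" "\<And>t. \<bar>t\<bar> < d \<Longrightarrow> x + t *\<^sub>R axis j 1 \<in> S"
    using line_in_open[OF assms(1,2)] by blast
  show ?thesis
    using DERIV_local_max[OF assms(3)[unfolded has_partial_def] d(1)] d(2) assms(4) by simp
qed

lemma second_partial_le_0_at_max: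
  assumes "open S" "x \<in> S"
    and w1: "\<And>y. y \<in> S \<Longrightarrow> has_partial j w (w1 y) y"
    and w2: "has_partial j w1 w2 x"
    and max: "\<And>y. y \<in> S \<Longrightarrow> w y \<le> w x"
  shows "w2 \<le> 0"
proof -
  obtain d where d: "d > 0" "\<And>t. \<bar>t\<bar> < d \<Longrightarrow> x + t *\<^sub>R axis j 1 \<in> S"
    using line_in_open[OF assms(1,2)] by blast
  show ?thesis
  proof (rule second_derivative_test[OF d(1)])
    show "((\<lambda>t. w (x + t *\<^sub>R axis j 1)) has_real_derivative w1 (x + t *\<^sub>R axis j 1)) (at t)"
      if "\<bar>t\<bar> < d" for t
      using w1[OF d(2)[OF that]] by (simp add: has_partial_line)
    show "((\<lambda>t. w1 (x + t *\<^sub>R axis j 1)) has_real_derivative w2) (at 0)"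
      using w2 by (simp add: has_partial_def)
  qed (use d(2) max in simp)
qed

section \<open>Difference quotients\<close>

definition diffquot :: "'n::finite \<Rightarrow> real \<Rightarrow> (real ^ 'n \<Rightarrow> real) \<Rightarrow> real ^ 'n \<Rightarrow> real" where
  "diffquot i h f x = (f (x + h *\<^sub>R axis i 1) - f x) / h"

text \<open>The mean value theorem turns the quotient into \<open>u1\<close> at a nearby point. Convergence is
stated jointly in the step and in the base point, because the base points will be
maximum points that move with the step.\<close>

lemma tendsto_diffquot:
  assumes "open S" "x \<in> S"
    and u: "\<And>y. y \<in> S \<Longrightarrow> has_partial i u (u1 y) y"
    and cont: "isCont u1 x"
  shows "((\<lambda>(h, y). diffquot i h u y) \<longlongrightarrow> u1 x) (at_right 0 \<times>\<^sub>F nhds x)"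
proof (rule tendstoI)
  fix e :: real assume "e > 0"
  obtain d1 where d1: "d1 > 0" "ball x d1 \<subseteq> S" using assms(1,2) openE by blast
  obtain d2 where d2: "d2 > 0" "\<And>y. dist y x < d2 \<Longrightarrow> dist (u1 y) (u1 x) < e"
    using cont \<open>e > 0\<close> unfolding continuous_at_eps_delta by blast
  define d where "d = min d1 d2 / 2"
  have d: "d > 0" "2 * d \<le> d1" "2 * d \<le> d2" using d1 d2 by (auto simp: d_def)
  have key: "dist (diffquot i h u y) (u1 x) < e" if h: "0 < h" "h < d" and y: "dist y x < d" for h y
  proof -
    have near: "dist (y + t *\<^sub>R axis i 1) x < 2 * d" if "0 \<le> t" "t \<le> h" for t
    proof -
      have "dist (y + t *\<^sub>R axis i 1) x \<le> dist (y + t *\<^sub>R axis i 1) y + dist y x"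
        by (rule dist_triangle)
      also have "dist (y + t *\<^sub>R axis i 1) y = t" using that by (simp add: dist_norm norm_axis_1)
      finally show ?thesis using that h y by simp
    qed
    have "\<exists>z>0. z < h \<and> u (y + h *\<^sub>R axis i 1) - u (y + 0 *\<^sub>R axis i 1)
                  = (h - 0) * u1 (y + z *\<^sub>R axis i 1)"
    proof (rule MVT2)
      fix t assume "0 \<le> t" "t \<le> h"
      then have "y + t *\<^sub>R axis i 1 \<in> S" using near[of t] d d1 by (auto simp: dist_commute)
      then show "((\<lambda>t. u (y + t *\<^sub>R axis i 1)) has_real_derivative u1 (y + t *\<^sub>R axis i 1)) (at t)"
        using u by (simp add: has_partial_line)
    qed (use h in auto)
    then obtain z where "0 < z" "z < h"
      "u (y + h *\<^sub>R axis i 1) - u y = h * u1 (y + z *\<^sub>R axis i 1)" by auto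
    then have "diffquot i h u y = u1 (y + z *\<^sub>R axis i 1)" using h by (simp add: diffquot_def)
    then show ?thesis using d2(2) near[of z] d \<open>0 < z\<close> \<open>z < h\<close> by force
  qed
  have "\<forall>\<^sub>F h in at_right (0::real). 0 < h \<and> h < d"
    using \<open>d > 0\<close> by (auto simp: eventually_at_right_field)
  moreover have "\<forall>\<^sub>F y in nhds x. dist y x < d"
    using \<open>d > 0\<close> by (auto simp: eventually_nhds_metric)
  ultimately show "\<forall>\<^sub>F q in at_right 0 \<times>\<^sub>F nhds x. dist (case q of (h, y) \<Rightarrow> diffquot i h u y) (u1 x) < e"
    unfolding eventually_prod_filter using key by (intro exI conjI) (assumption, assumption, auto)
qed

lemma has_partial_diffquot:
  assumes "\<And>y. has_partial j f (f1 y) y"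
  shows "has_partial j (diffquot i h f) (diffquot i h f1 x) x"
proof -
  have eq: "x + h *\<^sub>R axis i 1 + t *\<^sub>R axis j 1 = x + t *\<^sub>R axis j 1 + h *\<^sub>R axis i 1" for t
    by simp
  have "((\<lambda>t. f (x + h *\<^sub>R axis i 1 + t *\<^sub>R axis j 1)) has_real_derivative f1 (x + h *\<^sub>R axis i 1)) (at 0)"
       "((\<lambda>t. f (x + t *\<^sub>R axis j 1)) has_real_derivative f1 x) (at 0)"
    using assms by (simp_all add: has_partial_line)
  then show ?thesis
    unfolding has_partial_def diffquot_def eq by (intro DERIV_cdivide DERIV_diff)
qed

section \<open>Maximum principle for limits of twice differentiable functions\<close>

text \<open>The number \<open>g\<close> plays the role of the Laplacian of \<open>z\<close> at \<open>x\<close>, but \<open>z\<close> is only a limit of functions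
\<open>Z h\<close> whose Laplacians tend to \<open>g\<close>. If \<open>x\<close> were a strict maximum point of \<open>z - f\<close>, then maximum points of
\<open>Z h - f\<close> would converge to \<open>x\<close>; they are eventually interior, so the second derivative test holds at
them and passes to the limit. Adding \<open>|y - x|\<^sup>4\<close> to \<open>f\<close> makes the maximum strict and leaves the Laplacian at \<open>x\<close>
unchanged.\<close>

lemma touching_laplacian_le:
  fixes x :: "real ^ 'n::finite" and Z :: "real \<Rightarrow> real ^ 'n \<Rightarrow> real"
    and Z1 Z2 :: "'n \<Rightarrow> real \<Rightarrow> real ^ 'n \<Rightarrow> real"
  assumes "r > 0"
    and Zz: "\<And>y. y \<in> cball x r \<Longrightarrow> ((\<lambda>(h, y). Z h y) \<longlongrightarrow> z y) (at_right 0 \<times>\<^sub>F nhds y)"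
    and Zg: "((\<lambda>(h, y). \<Sum>j\<in>UNIV. Z2 j h y) \<longlongrightarrow> g) (at_right 0 \<times>\<^sub>F nhds x)"
    and Zc: "\<And>h. h > 0 \<Longrightarrow> continuous_on (cball x r) (Z h)"
    and Z1: "\<And>h j y. h > 0 \<Longrightarrow> y \<in> ball x r \<Longrightarrow> has_partial j (Z h) (Z1 j h y) y"
    and Z2: "\<And>h j y. h > 0 \<Longrightarrow> y \<in> ball x r \<Longrightarrow> has_partial j (Z1 j h) (Z2 j h y) y"
    and fc: "continuous_on (cball x r) f"
    and f1: "\<And>j y. y \<in> ball x r \<Longrightarrow> has_partial j f (f1 j y) y"
    and f2: "\<And>j y. y \<in> ball x r \<Longrightarrow> has_partial j (f1 j) (f2 j y) y"
    and f2c: "isCont (\<lambda>y. \<Sum>j\<in>UNIV. f2 j y) x"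
    and touch: "\<And>y. y \<in> cball x r \<Longrightarrow> z y - f y \<le> z x - f x"
  shows "g \<le> (\<Sum>j\<in>UNIV. f2 j x)"
proof -
  define Q where "Q = (\<lambda>y::real^'n. ((y - x) \<bullet> (y - x)) * ((y - x) \<bullet> (y - x)))"
  define Q1 where "Q1 = (\<lambda>j (y::real^'n). 4 * (((y - x) \<bullet> (y - x)) * (y - x) $ j))"
  define Q2 where "Q2 = (\<lambda>j (y::real^'n). 4 * (2 * (y - x) $ j * (y - x) $ j + (y - x) \<bullet> (y - x)))"
  have Q1: "has_partial j Q (Q1 j y) y" for j y
  proof -
    have eq: "2 * b * a + 2 * b * a = 4 * (a * b)" for a b :: real by simp
    have "2 * (y - x) $ j * ((y - x) \<bullet> (y - x)) + 2 * (y - x) $ j * ((y - x) \<bullet> (y - x)) = Q1 j y"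
      unfolding Q1_def by (simp only: eq)
    then show ?thesis
      using has_partial_mult[OF has_partial_dist_square[of j x y] has_partial_dist_square[of j x y]]
      unfolding Q_def by metis
  qed
  have Q2: "has_partial j (Q1 j) (Q2 j y) y" for j y
    using has_partial_cmult[OF has_partial_mult[OF has_partial_dist_square[of j x y] has_partial_nth[of j x y]], of 4]
    unfolding Q1_def Q2_def by (simp only: mult_1)
  define h where "h = (\<lambda>k::nat. inverse (real (Suc k)))"
  have h0: "h k > 0" for k by (simp add: h_def)
  have hlim: "filterlim h (at_right 0) sequentially"
    unfolding filterlim_at using h0 LIMSEQ_inverse_real_of_nat
    by (auto simp: h_def)
  have "\<exists>y. y \<in> cball x r \<and> (\<forall>y'\<in>cball x r. Z (h k) y' - f y' - Q y' \<le> Z (h k) y - f y - Q y)" for k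
    using continuous_attains_sup[of "cball x r" "\<lambda>y. Z (h k) y - f y - Q y"] \<open>r > 0\<close>
    unfolding Q_def by (force intro!: continuous_intros Zc fc h0)
  then obtain X where X: "\<And>k. X k \<in> cball x r"
    and Xmax: "\<And>k y. y \<in> cball x r \<Longrightarrow> Z (h k) y - f y - Q y \<le> Z (h k) (X k) - f (X k) - Q (X k)"
    by metis
  obtain y \<rho> where y: "y \<in> cball x r" and \<rho>: "strict_mono (\<rho> :: nat \<Rightarrow> nat)" and lim: "(X \<circ> \<rho>) \<longlonglongrightarrow> y"
    using compact_cball[of x r] X unfolding compact_def by blast
  have h\<rho>: "filterlim (\<lambda>k. h (\<rho> k)) (at_right 0) sequentially"
    using filterlim_compose[OF hlim filterlim_subseq[OF \<rho>]] .
  have X\<rho>: "filterlim (\<lambda>k. X (\<rho> k)) (nhds y) sequentially"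
    using lim by (simp add: o_def)
  have ZX: "(\<lambda>k. Z (h (\<rho> k)) (X (\<rho> k))) \<longlonglongrightarrow> z y"
    using filterlim_compose[OF Zz[OF y] filterlim_Pair[OF h\<rho> X\<rho>]] by simp
  have "x \<in> cball x r" using \<open>r > 0\<close> by simp
  then have Zx: "(\<lambda>k. Z (h (\<rho> k)) x) \<longlonglongrightarrow> z x"
    using filterlim_compose[OF Zz filterlim_Pair[OF h\<rho> tendsto_const[of x]]] by simp
  have fX: "(\<lambda>k. f (X (\<rho> k))) \<longlonglongrightarrow> f y"
    using fc y lim X unfolding continuous_on_sequentially by (auto simp: o_def)
  have QX: "(\<lambda>k. Q (X (\<rho> k))) \<longlonglongrightarrow> Q y"
    unfolding Q_def by (intro tendsto_intros X\<rho>)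
  (* The limit point y of the maximum points is itself a maximum point of z - f - Q, and x is the only one. *)
  have "z x - f x - Q x \<le> z y - f y - Q y"
    by (rule LIMSEQ_le[OF tendsto_diff[OF tendsto_diff[OF Zx tendsto_const] tendsto_const]
          tendsto_diff[OF tendsto_diff[OF ZX fX] QX]])
      (use Xmax \<open>x \<in> cball x r\<close> in blast)
  moreover have "Q x = 0" by (simp add: Q_def)
  ultimately have "Q y \<le> 0" using touch[OF y] by simp
  then have "y = x"
    unfolding Q_def by (metis inner_gt_zero_iff mult_pos_pos not_less right_minus_eq)
  have "\<forall>\<^sub>F k in sequentially. X (\<rho> k) \<in> ball x r"
    using topological_tendstoD[OF X\<rho> open_ball, of x r] \<open>r > 0\<close> \<open>y = x\<close> by simp
  then have le: "\<forall>\<^sub>F k in sequentially. (\<Sum>j\<in>UNIV. Z2 j (h (\<rho> k)) (X (\<rho> k))) \<le>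
      (\<Sum>j\<in>UNIV. f2 j (X (\<rho> k))) + (\<Sum>j\<in>UNIV. Q2 j (X (\<rho> k)))"
  proof eventually_elim
    case (elim k)
    have "Z2 j (h (\<rho> k)) (X (\<rho> k)) - f2 j (X (\<rho> k)) - Q2 j (X (\<rho> k)) \<le> 0" for j
    proof (rule second_partial_le_0_at_max[OF open_ball elim])
      show "has_partial j (\<lambda>y. Z (h (\<rho> k)) y - f y - Q y) (Z1 j (h (\<rho> k)) y - f1 j y - Q1 j y) y"
        if "y \<in> ball x r" for y
        using that by (intro has_partial_diff Z1 f1 Q1 h0)
      show "has_partial j (\<lambda>y. Z1 j (h (\<rho> k)) y - f1 j y - Q1 j y)
        (Z2 j (h (\<rho> k)) (X (\<rho> k)) - f2 j (X (\<rho> k)) - Q2 j (X (\<rho> k))) (X (\<rho> k))"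
        by (intro has_partial_diff Z2 f2 Q2 h0 elim)
    qed (use Xmax in auto)
    then have "(\<Sum>j\<in>UNIV. Z2 j (h (\<rho> k)) (X (\<rho> k))) \<le> (\<Sum>j\<in>UNIV. f2 j (X (\<rho> k)) + Q2 j (X (\<rho> k)))"
      by (intro sum_mono) (simp add: algebra_simps)
    then show ?case by (simp add: sum.distrib)
  qed
  have lim1: "(\<lambda>k. \<Sum>j\<in>UNIV. Z2 j (h (\<rho> k)) (X (\<rho> k))) \<longlonglongrightarrow> g"
    using filterlim_compose[OF Zg filterlim_Pair[OF h\<rho> X\<rho>[unfolded \<open>y = x\<close>]]] by simp
  have lim2: "(\<lambda>k. (\<Sum>j\<in>UNIV. f2 j (X (\<rho> k))) + (\<Sum>j\<in>UNIV. Q2 j (X (\<rho> k))))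
      \<longlonglongrightarrow> (\<Sum>j\<in>UNIV. f2 j x) + (\<Sum>j\<in>UNIV. Q2 j x)"
    unfolding Q2_def
    by (intro tendsto_intros X\<rho>[unfolded \<open>y = x\<close>] isCont_tendsto_compose[OF f2c])
  have "g \<le> (\<Sum>j\<in>UNIV. f2 j x) + (\<Sum>j\<in>UNIV. Q2 j x)"
    by (rule tendsto_le[OF sequentially_bot lim2 lim1 le])
  then show ?thesis by (simp add: Q2_def)
qed

section \<open>Bochner's formula for functions of class \<open>C\<^sup>2\<close>\<close>

lemma C2_partials:
  assumes "C2_function v"
  shows "has_partial j v (partial_derivative j v y) y"
    and "has_partial j (partial_derivative i v) (partial_derivative j (partial_derivative i v) y) y"
    and "isCont (partial_derivative i v) y"
    and "isCont (partial_derivative j (partial_derivative i v)) y"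
    and "isCont v y"
proof -
  have C1: "C1_function v" "C1_function (partial_derivative i v)"
    using assms by (simp_all add: C2_function_def)
  have diff: "f differentiable (at z)" if "C1_function f" for f and z :: "real ^ 'a"
    using that by (simp add: C1_function_def)
  have cont: "isCont (partial_derivative l f) z" if "C1_function f" for f l and z :: "real ^ 'a"
    using that by (simp add: C1_function_def continuous_on_eq_continuous_at)
  show "has_partial j v (partial_derivative j v y) y"
    and "has_partial j (partial_derivative i v) (partial_derivative j (partial_derivative i v) y) y"
    by (rule has_partial_partial_derivative[OF diff[OF C1(1)]],
        rule has_partial_partial_derivative[OF diff[OF C1(2)]])
  show "isCont (partial_derivative i v) y" "isCont (partial_derivative j (partial_derivative i v)) y"
    by (rule cont[OF C1(1)], rule cont[OF C1(2)])
  show "isCont v y"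
    using diff[OF C1(1)] by (rule differentiable_imp_continuous_within)
qed

lemma norm_grad_square: "(norm (grad v y))\<^sup>2 = (\<Sum>i\<in>UNIV. (partial_derivative i v y)\<^sup>2)"
  unfolding power2_norm_eq_inner by (simp add: inner_vec_def grad_def power2_eq_square)

text \<open>Bochner's formula in the sense of touching from above: \<open>f\<close> satisfies \<open>\<Delta>f \<ge> 2|D\<^sup>2v|\<^sup>2 + 2 \<nabla>v \<bullet> \<nabla>(\<Delta>v)\<close> at a point
where it touches \<open>|\<nabla>v|\<^sup>2\<close> from above up to a constant. The approximations are the sums of
squared difference quotients of \<open>v\<close>: two derivatives fall on \<open>v\<close>, and the difference quotient of the
Laplacian supplies the third one, through \<open>F1\<close>.\<close>

lemma bochner_touching:
  fixes v :: "real ^ 'n::finite \<Rightarrow> real"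
  assumes C2: "C2_function v" and S: "open S" "x \<in> S"
    and F1: "\<And>i y. y \<in> S \<Longrightarrow> has_partial i (laplacian v) (F1 i y) y"
    and F1c: "\<And>i. isCont (F1 i) x"
    and fc: "continuous_on S f"
    and f1: "\<And>j y. y \<in> S \<Longrightarrow> has_partial j f (f1 j y) y"
    and f2: "\<And>j y. y \<in> S \<Longrightarrow> has_partial j (f1 j) (f2 j y) y"
    and f2c: "isCont (\<lambda>y. \<Sum>j\<in>UNIV. f2 j y) x"
    and touch: "\<And>y. y \<in> S \<Longrightarrow> (norm (grad v y))\<^sup>2 - f y \<le> (norm (grad v x))\<^sup>2 - f x"
  shows "2 * (\<Sum>i\<in>UNIV. \<Sum>j\<in>UNIV. (partial_derivative i (partial_derivative j v) x)\<^sup>2)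
         + 2 * (\<Sum>i\<in>UNIV. partial_derivative i v x * F1 i x) \<le> (\<Sum>j\<in>UNIV. f2 j x)"
proof -
  let ?D = "\<lambda>i. partial_derivative i v"
  let ?DD = "\<lambda>j i. partial_derivative j (partial_derivative i v)"
  define Z where "Z = (\<lambda>h y. \<Sum>i\<in>UNIV. diffquot i h v y * diffquot i h v y)"
  define Z1 where "Z1 = (\<lambda>j h y. \<Sum>i\<in>UNIV. 2 * (diffquot i h v y * diffquot i h (?D j) y))"
  define Z2 where "Z2 = (\<lambda>j h y. \<Sum>i\<in>UNIV. 2 * (diffquot i h (?D j) y * diffquot i h (?D j) y
                                  + diffquot i h (?DD j j) y * diffquot i h v y))"
  obtain r where r: "r > 0" "cball x r \<subseteq> S" using S open_contains_cball by blast
  have ball: "y \<in> S" if "y \<in> ball x r" for y using that r ball_subset_cball by blast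
  have dqv: "((\<lambda>w. diffquot i (fst w) v (snd w)) \<longlongrightarrow> ?D i y) (at_right 0 \<times>\<^sub>F nhds y)" for i y
    using tendsto_diffquot[OF open_UNIV UNIV_I C2_partials(1)[OF C2] C2_partials(3)[OF C2]]
    by (simp add: case_prod_beta')
  have dqD: "((\<lambda>w. diffquot i (fst w) (?D j) (snd w)) \<longlongrightarrow> ?DD i j y) (at_right 0 \<times>\<^sub>F nhds y)" for i j y
    using tendsto_diffquot[OF open_UNIV UNIV_I C2_partials(2)[OF C2] C2_partials(4)[OF C2]]
    by (simp add: case_prod_beta')
  have dqF: "((\<lambda>w. diffquot i (fst w) (laplacian v) (snd w)) \<longlongrightarrow> F1 i x) (at_right 0 \<times>\<^sub>F nhds x)" for i
    using tendsto_diffquot[OF S F1 F1c] by (simp add: case_prod_beta')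
  have dqsum: "(\<Sum>j\<in>UNIV. diffquot i h (?DD j j) y) = diffquot i h (laplacian v) y" for i h y
    by (simp add: diffquot_def laplacian_def sum_divide_distrib sum_subtractf diff_divide_distrib)
  have Z2sum: "(\<Sum>j\<in>UNIV. Z2 j h y) = (\<Sum>i\<in>UNIV. 2 * ((\<Sum>j\<in>UNIV. diffquot i h (?D j) y * diffquot i h (?D j) y)
       + diffquot i h (laplacian v) y * diffquot i h v y))" for h y
    unfolding Z2_def
    by (subst sum.swap) (simp add: sum_distrib_left[symmetric] sum.distrib sum_distrib_right[symmetric] dqsum)
  have "(\<Sum>i\<in>UNIV. 2 * ((\<Sum>j\<in>UNIV. ?DD i j x * ?DD i j x) + F1 i x * ?D i x)) \<le> (\<Sum>j\<in>UNIV. f2 j x)"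
  proof (rule touching_laplacian_le[OF r(1), where Z = Z and ?Z1.0 = Z1 and ?Z2.0 = Z2 and f = f and ?f1.0 = f1
        and z = "\<lambda>y. (norm (grad v y))\<^sup>2"])
    show "((\<lambda>(h, y). Z h y) \<longlongrightarrow> (norm (grad v y))\<^sup>2) (at_right 0 \<times>\<^sub>F nhds y)" for y
      unfolding Z_def case_prod_beta' norm_grad_square unfolding power2_eq_square
      by (intro tendsto_intros dqv)
    show "((\<lambda>(h, y). \<Sum>j\<in>UNIV. Z2 j h y) \<longlongrightarrow>
            (\<Sum>i\<in>UNIV. 2 * ((\<Sum>j\<in>UNIV. ?DD i j x * ?DD i j x) + F1 i x * ?D i x))) (at_right 0 \<times>\<^sub>F nhds x)"
      unfolding Z2sum case_prod_beta' by (intro tendsto_intros dqv dqD dqF)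
    have "continuous_on UNIV v"
      using C2_partials(5)[OF C2] by (simp add: continuous_on_eq_continuous_at)
    then have "continuous_on (cball x r) (\<lambda>y. v (y + c))" for c
      by (rule continuous_on_compose2) (auto intro: continuous_intros)
    from this this[of 0] show "continuous_on (cball x r) (Z h)" for h
      unfolding Z_def diffquot_def divide_inverse by (intro continuous_intros) auto
    show "has_partial j (Z h) (Z1 j h y) y" for j h y
    proof -
      have "has_partial j (Z h) (\<Sum>i\<in>UNIV. diffquot i h (?D j) y * diffquot i h v y
                                     + diffquot i h (?D j) y * diffquot i h v y) y"
        unfolding Z_def by (intro has_partial_sum has_partial_mult has_partial_diffquot C2_partials(1) C2)
      then show ?thesis by (simp add: Z1_def mult.commute)
    qed
    show "has_partial j (Z1 j h) (Z2 j h y) y" for j h y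
    proof -
      have "has_partial j (Z1 j h) (\<Sum>i\<in>UNIV. 2 * (diffquot i h (?D j) y * diffquot i h (?D j) y
                                     + diffquot i h (?DD j j) y * diffquot i h v y)) y"
        unfolding Z1_def
        by (intro has_partial_sum has_partial_cmult has_partial_mult has_partial_diffquot C2_partials(1,2) C2)
      then show ?thesis by (simp add: Z2_def)
    qed
    show "continuous_on (cball x r) f" using fc r continuous_on_subset by blast
  qed (use r f1[OF ball] f2[OF ball] f2c touch in auto)
  then show ?thesis
    by (simp add: sum.distrib sum_distrib_left power2_eq_square algebra_simps)
qed

section \<open>The differential inequality for the squared gradient\<close>

text \<open>With \<open>a = s powr p\<close> and \<open>b = t powr (q/2)\<close> the left-hand side is
\<open>a powr (1 - 1/p) * b powr (1 + 1/p)\<close>. The exponents add up to 2 and that of \<open>b\<close> exceeds 1, so one factor \<open>b\<close> can be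
split off and the rest is at most \<open>max a b\<close>.\<close>

lemma powr_interpolation:
  fixes p s t :: real
  assumes "p > 1" "q = 2 * p / (p + 1)" "s > 0" "t > 0"
  shows "s powr (p - 1) * t \<le> t powr (q / 2) * (s powr p + t powr (q / 2))"
proof -
  define a b m where "a = s powr p" and "b = t powr (q / 2)" and "m = max a b"
  have pos: "a > 0" "b > 0" using assms by (auto simp: a_def b_def)
  have "p * (1 - 1 / p) = p - 1" using assms by (simp add: algebra_simps)
  then have "s powr (p - 1) = a powr (1 - 1 / p)"
    by (simp add: a_def powr_powr)
  also have "\<dots> \<le> m powr (1 - 1 / p)"
    using assms pos by (intro powr_mono2) (auto simp: m_def)
  finally have 1: "s powr (p - 1) \<le> m powr (1 - 1 / p)" .
  have "q / 2 * (1 + 1 / p) = 1" using assms by (simp add: field_simps)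
  then have "t powr (q / 2 * (1 + 1 / p)) = t" using assms by (simp only: powr_one)
  then have "t = b powr (1 + 1 / p)" by (simp only: b_def powr_powr)
  then have "t = b * b powr (1 / p)" using pos by (simp add: powr_add)
  also have "\<dots> \<le> b * m powr (1 / p)"
    using assms pos by (intro mult_left_mono powr_mono2) (auto simp: m_def)
  finally have "s powr (p - 1) * t \<le> m powr (1 - 1 / p) * (b * m powr (1 / p))"
    using 1 assms by (intro mult_mono) auto
  also have "\<dots> = b * m powr (1 - 1 / p + 1 / p)"
    unfolding powr_add by simp
  also have "\<dots> = b * m" using pos by (simp add: m_def)
  also have "\<dots> \<le> b * (a + b)" using pos by (intro mult_left_mono) (auto simp: m_def)
  finally show ?thesis by (simp add: a_def b_def)
qed

lemma laplacian_square_le: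
  fixes v :: "real ^ 'n::finite \<Rightarrow> real"
  shows "(laplacian v x)\<^sup>2 \<le> real CARD('n) *
    (\<Sum>i\<in>UNIV. \<Sum>j\<in>UNIV. (partial_derivative i (partial_derivative j v) x)\<^sup>2)"
proof -
  have "(laplacian v x)\<^sup>2 \<le> real CARD('n) * (\<Sum>i\<in>UNIV. (partial_derivative i (partial_derivative i v) x)\<^sup>2)"
    using Cauchy_Schwarz_ineq_sum[of "\<lambda>i. 1" "\<lambda>i. partial_derivative i (partial_derivative i v) x" UNIV]
    by (simp add: laplacian_def)
  also have "\<dots> \<le> real CARD('n) *
    (\<Sum>i\<in>UNIV. \<Sum>j\<in>UNIV. (partial_derivative i (partial_derivative j v) x)\<^sup>2)"
    by (intro mult_left_mono sum_mono member_le_sum) auto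
  finally show ?thesis .
qed

text \<open>The inequality \<open>2 z\<^sup>q \<le> \<Delta>z + M q z\<^bsup>q/2-1\<^esup> \<nabla>v \<bullet> \<nabla>z\<close> for \<open>z = |\<nabla>v|\<^sup>2\<close>, with the derivatives of \<open>z\<close> replaced by
those of a function touching it from above. A point with \<open>\<nabla>v \<noteq> 0\<close> has \<open>v > 0\<close>, since the zeros of \<open>v\<close>
are minima; near it both powers in the equation are differentiable, so \<open>\<Delta>v\<close> has continuous partial
derivatives and Bochner's formula applies.\<close>

lemma gradient_touching:
  fixes v :: "real ^ 'n::finite \<Rightarrow> real"
  assumes p: "p > 1" and q: "q = 2 * p / (p + 1)" and M: "M \<ge> real CARD('n) * (p + 1)"
    and C2: "C2_function v" and nonneg: "\<And>y. v y \<ge> 0"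
    and eqn: "\<And>y. laplacian v y + v y powr p + M * norm (grad v y) powr q = 0"
    and S: "open S" "x \<in> S" and nz: "grad v x \<noteq> 0"
    and fc: "continuous_on S f"
    and f1: "\<And>j y. y \<in> S \<Longrightarrow> has_partial j f (f1 j y) y"
    and f2: "\<And>j y. y \<in> S \<Longrightarrow> has_partial j (f1 j) (f2 j y) y"
    and f2c: "isCont (\<lambda>y. \<Sum>j\<in>UNIV. f2 j y) x"
    and touch: "\<And>y. y \<in> S \<Longrightarrow> (norm (grad v y))\<^sup>2 - f y \<le> (norm (grad v x))\<^sup>2 - f x"
  shows "2 * ((norm (grad v x))\<^sup>2) powr q \<le> (\<Sum>j\<in>UNIV. f2 j x)
    + M * q * ((norm (grad v x))\<^sup>2) powr (q / 2 - 1) * (\<Sum>i\<in>UNIV. partial_derivative i v x * f1 i x)"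
proof -
  let ?D = "\<lambda>i. partial_derivative i v"
  let ?DD = "\<lambda>j i. partial_derivative j (partial_derivative i v)"
  define z where "z = (\<lambda>y. (norm (grad v y))\<^sup>2)"
  define z1 where "z1 = (\<lambda>i y. \<Sum>l\<in>UNIV. ?DD i l y * ?D l y + ?DD i l y * ?D l y)"
  have zsum: "z = (\<lambda>y. \<Sum>l\<in>UNIV. ?D l y * ?D l y)"
    unfolding z_def norm_grad_square unfolding power2_eq_square ..
  have z1: "has_partial i z (z1 i y) y" for i y
    unfolding zsum z1_def by (intro has_partial_sum has_partial_mult C2_partials(2) C2)
  have zc: "isCont z y" for y
    unfolding zsum by (intro continuous_intros C2_partials(3) C2)
  have z1c: "isCont (z1 i) y" for i y
    unfolding z1_def by (intro continuous_intros C2_partials(3,4) C2)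
  have vc: "isCont v y" for y using C2_partials(5)[OF C2] .
  have eqn': "laplacian v y = - (v y powr p) - M * z y powr (q / 2)" for y
  proof -
    have eq: "z y powr (q / 2) = norm (grad v y) powr q"
    proof (cases "grad v y = 0")
      case False
      then show ?thesis
        by (simp add: z_def powr_powr flip: powr_numeral)
    qed (simp add: z_def)
    show ?thesis unfolding eq using eqn[of y] by linarith
  qed
  define T where "T = S \<inter> {y. v y > 0} \<inter> {y. z y > 0}"
  have "open T"
    unfolding T_def using S(1) vc zc
    by (intro open_Int open_Collect_less continuous_on_const)
      (auto simp: continuous_on_eq_continuous_at)
  have "z x > 0" using nz by (simp add: z_def)
  have "v x > 0"
  proof (rule ccontr)
    assume "\<not> v x > 0"
    then have "v x = 0" using nonneg[of x] by linarith
    have "0 - ?D i x = 0" for i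
      by (rule partial_eq_0_at_max[OF open_UNIV UNIV_I has_partial_diff[OF has_partial_const C2_partials(1)[OF C2]]])
        (use nonneg \<open>v x = 0\<close> in simp)
    then have "grad v x = 0" by (simp add: grad_def vec_eq_iff)
    then show False using nz by simp
  qed
  have "x \<in> T" using S \<open>z x > 0\<close> \<open>v x > 0\<close> by (simp add: T_def)
  have "z1 i x - f1 i x = 0" for i
    by (rule partial_eq_0_at_max[OF S has_partial_diff[OF z1 f1[OF S(2)]]])
      (use touch in \<open>simp add: z_def\<close>)
  then have first: "z1 i x = f1 i x" for i by simp
  define F1 where "F1 = (\<lambda>i y. (-1) * (p * v y powr (p - 1) * ?D i y)
                     - M * (q / 2 * z y powr (q / 2 - 1) * z1 i y))"
  have F1: "has_partial i (laplacian v) (F1 i y) y" if "y \<in> T" for i y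
  proof -
    have "has_partial i (\<lambda>y. (-1) * v y powr p - M * z y powr (q / 2)) (F1 i y) y"
      unfolding F1_def
      by (intro has_partial_diff has_partial_cmult has_partial_powr C2_partials(1) C2 z1)
        (use that in \<open>auto simp: T_def\<close>)
    then show ?thesis by (simp add: eqn'[abs_def])
  qed
  have F1c: "isCont (F1 i) x" for i
    unfolding F1_def
    by (intro continuous_intros vc zc z1c C2_partials(3) C2) (use \<open>v x > 0\<close> \<open>z x > 0\<close> in auto)
  define H where "H = (\<Sum>i\<in>UNIV. \<Sum>j\<in>UNIV. (?DD i j x)\<^sup>2)"
  have fcT: "continuous_on T f" using fc by (rule continuous_on_subset) (auto simp: T_def)
  have boch: "2 * H + 2 * (\<Sum>i\<in>UNIV. ?D i x * F1 i x) \<le> (\<Sum>j\<in>UNIV. f2 j x)"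
    unfolding H_def
    by (rule bochner_touching[OF C2 \<open>open T\<close> \<open>x \<in> T\<close> F1 F1c fcT, where ?f1.0 = f1])
      (use f1 f2 f2c touch in \<open>auto simp: T_def\<close>)
  have Dsq: "(\<Sum>i\<in>UNIV. ?D i x * ?D i x) = z x" by (simp add: zsum)
  have "(\<Sum>i\<in>UNIV. ?D i x * F1 i x) =
      (\<Sum>i\<in>UNIV. (- p * v x powr (p - 1)) * (?D i x * ?D i x)
        + (- M * (q / 2) * z x powr (q / 2 - 1)) * (?D i x * f1 i x))"
    unfolding F1_def first by (intro sum.cong refl) (simp add: algebra_simps)
  also have "\<dots> = (- p * v x powr (p - 1)) * z x
        + (- M * (q / 2) * z x powr (q / 2 - 1)) * (\<Sum>i\<in>UNIV. ?D i x * f1 i x)"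
    by (simp only: sum.distrib sum_distrib_left[symmetric] Dsq)
  finally have DF: "2 * (\<Sum>i\<in>UNIV. ?D i x * F1 i x) = - (2 * p * (v x powr (p - 1) * z x))
        - M * q * z x powr (q / 2 - 1) * (\<Sum>i\<in>UNIV. ?D i x * f1 i x)"
    by (simp add: algebra_simps)
  define a b n where "a = v x powr p" and "b = z x powr (q / 2)" and "n = real CARD('n)"
  have ab: "a > 0" "b > 0" using \<open>v x > 0\<close> \<open>z x > 0\<close> by (auto simp: a_def b_def)
  have n: "n \<ge> 1" by (simp add: n_def Suc_leI)
  have M1: "M \<ge> n * (p + 1)" using M by (simp add: n_def)
  have "1 * 1 \<le> n * (p + 1)" using n p by (intro mult_mono) auto
  then have M2: "M \<ge> 1" using M1 by linarith
  have "(a + M * b)\<^sup>2 \<le> n * H"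
    using laplacian_square_le[of v x] unfolding eqn' H_def a_def b_def n_def
    by (simp add: power2_eq_square algebra_simps)
  (* From the square only 2 M a b + M^2 b^2 is kept; this is where M >= n (p + 1) enters. *)
  moreover have "n * ((p + 1) * (b * (a + b))) \<le> (a + M * b)\<^sup>2"
  proof -
    have "n * ((p + 1) * (b * (a + b))) = (n * (p + 1)) * (b * (a + b))" by simp
    also have "\<dots> \<le> M * (b * (a + b))" using M1 ab by (intro mult_right_mono) auto
    also have "\<dots> \<le> M * (b * (2 * a + M * b))"
      using M2 ab by (intro mult_left_mono add_mono) auto
    also have "\<dots> \<le> (a + M * b)\<^sup>2" using ab by (simp add: power2_eq_square algebra_simps)
    finally show ?thesis .
  qed
  ultimately have "n * ((p + 1) * (b * (a + b))) \<le> n * H" by linarith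
  then have "(p + 1) * (b * (a + b)) \<le> H" using n by simp
  moreover have "p * (v x powr (p - 1) * z x) \<le> p * (b * (a + b))"
    using powr_interpolation[OF p q \<open>v x > 0\<close> \<open>z x > 0\<close>] p unfolding a_def b_def
    by (intro mult_left_mono) auto
  moreover have "b * b \<le> b * (a + b)" using ab by simp
  ultimately have "2 * (b * b) \<le> 2 * H - 2 * p * (v x powr (p - 1) * z x)"
    by (simp add: algebra_simps)
  moreover have "b * b = z x powr q" by (simp add: b_def flip: powr_add)
  ultimately show ?thesis using boch DF unfolding z_def by linarith
qed

section \<open>Interior gradient estimate\<close>

lemma quadratic_bound:
  fixes t K C :: real
  assumes "2 * t\<^sup>2 \<le> 2 * K * t + C" "K \<ge> 0" "C \<ge> 0"
  shows "t \<le> 1 + K + C"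
proof (rule ccontr)
  assume "\<not> t \<le> 1 + K + C"
  then have t: "t > 1 + K + C" by simp
  have "(1 + K + C) * t \<le> t * t" using t assms by (intro mult_right_mono) auto
  moreover have "C * 1 \<le> C * t" using t assms by (intro mult_left_mono) auto
  moreover have "t > 0" using t assms by simp
  ultimately have "K * t + t + C \<le> t\<^sup>2" by (simp add: power2_eq_square algebra_simps)
  then show False using assms \<open>t > 0\<close> by linarith
qed

text \<open>Let \<open>s y = R\<^sup>2 - |y-a|\<^sup>2\<close> and let \<open>x\<close> maximise \<open>z s\<^sup>k\<close> on the closed ball, with maximum \<open>L > 0\<close>. Then
\<open>f = L s\<^sup>-\<^sup>k\<close> touches \<open>z\<close> from above at \<open>x\<close>, and each derivative of \<open>f\<close> costs a factor of order \<open>R/s\<close>. The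
inequality for \<open>z\<close> becomes quadratic in \<open>t = z\<^bsup>(q-1)/2\<^esup> s / R\<close>, with coefficients that do not
involve \<open>R\<close>; hence \<open>t \<le> B\<close>. The choice \<open>k = 2/(q-1)\<close> makes \<open>L = (R t)\<^sup>k\<close>, so \<open>L \<le> (R B)\<^sup>k\<close>, and the claim is
the comparison of the value of \<open>z s\<^sup>k\<close> at the centre with \<open>L\<close>.\<close>

lemma gradient_estimate:
  fixes v :: "real ^ 'n::finite \<Rightarrow> real"
  assumes p: "p > 1" and q: "q = 2 * p / (p + 1)" and M: "M \<ge> real CARD('n) * (p + 1)"
    and C2: "C2_function v" and nonneg: "\<And>y. v y \<ge> 0"
    and eqn: "\<And>y. laplacian v y + v y powr p + M * norm (grad v y) powr q = 0"
    and k: "k = 2 / (q - 1)" and B: "B = 1 + M * q * k + (4 * k * (k + 1) + 2 * real CARD('n) * k)"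
    and R: "R > 0"
  shows "(norm (grad v a))\<^sup>2 \<le> (B / R) powr k"
proof -
  define n where "n = real CARD('n)"
  define z where "z = (\<lambda>y. (norm (grad v y))\<^sup>2)"
  define s where "s = (\<lambda>y. R\<^sup>2 - (y - a) \<bullet> (y - a))"
  have q1: "q > 1" using p unfolding q by (simp add: field_simps)
  have k0: "k > 0" using q1 by (simp add: k)
  have M0: "M \<ge> 0" using M p by (smt (verit) mult_nonneg_nonneg of_nat_0_le_iff)
  have MqK: "M * q * k \<ge> 0" using M0 q1 k0 by simp
  have C0: "4 * k * (k + 1) + 2 * real CARD('n) * k \<ge> 0" using k0 by simp
  have B0: "B > 0" unfolding B using MqK C0 by linarith
  have sR: "s y \<le> R\<^sup>2" for y by (simp add: s_def)
  have dist: "(norm (y - a))\<^sup>2 = R\<^sup>2 - s y" for y by (simp add: s_def power2_norm_eq_inner)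
  have spos: "s y > 0 \<longleftrightarrow> y \<in> ball a R" for y
  proof -
    have "s y > 0 \<longleftrightarrow> (norm (y - a))\<^sup>2 < R\<^sup>2" unfolding dist by simp
    also have "\<dots> \<longleftrightarrow> norm (y - a) < R" using R
      by (metis less_imp_le norm_ge_zero power2_less_imp_less power_strict_mono zero_less_numeral)
    finally show ?thesis by (simp add: dist_norm norm_minus_commute)
  qed
  have snn: "s y \<ge> 0" if "y \<in> cball a R" for y
  proof -
    have "(norm (y - a))\<^sup>2 \<le> R\<^sup>2"
      using that by (intro power_mono) (auto simp: dist_norm norm_minus_commute)
    then show ?thesis unfolding dist by simp
  qed
  have zc: "continuous_on A z" for A
  proof -
    have "isCont z y" for y
      unfolding z_def norm_grad_square by (intro continuous_intros C2_partials(3) C2)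
    then show ?thesis by (simp add: continuous_at_imp_continuous_on)
  qed
  have "continuous_on (cball a R) (\<lambda>y. z y * s y powr k)"
    using snn k0 unfolding s_def
    by (intro continuous_intros zc continuous_on_powr') auto
  then obtain x where x: "x \<in> cball a R"
    and xmax: "\<And>y. y \<in> cball a R \<Longrightarrow> z y * s y powr k \<le> z x * s x powr k"
    using continuous_attains_sup[of "cball a R" "\<lambda>y. z y * s y powr k"] R by auto
  define L where "L = z x * s x powr k"
  have "L \<le> (R * B) powr k"
  proof (cases "z x > 0 \<and> s x > 0")
    case False
    then have "L = 0" using snn[OF x] by (auto simp: L_def z_def)
    then show ?thesis by simp
  next
    case True
    then have zx: "z x > 0" and sx: "s x > 0" by auto
    define f where "f = (\<lambda>y. L * s y powr (- k))"
    define f1 where "f1 = (\<lambda>j y. 2 * k * L * (s y powr (- k - 1) * (y - a) $ j))"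
    define f2 where "f2 = (\<lambda>j y. 2 * k * L * ((- k - 1) * s y powr (- k - 1 - 1) * (0 - 2 * (y - a) $ j) * (y - a) $ j
                       + 1 * s y powr (- k - 1)))"
    have s1: "has_partial j s (0 - 2 * (y - a) $ j) y" for j y
      unfolding s_def by (intro has_partial_diff has_partial_const has_partial_dist_square)
    have f1: "has_partial j f (f1 j y) y" if "y \<in> ball a R" for j y
    proof -
      have "has_partial j f (L * (- k * s y powr (- k - 1) * (0 - 2 * (y - a) $ j))) y"
        unfolding f_def using that
        by (intro has_partial_cmult has_partial_powr s1) (simp add: spos)
      moreover have "L * (- k * s y powr (- k - 1) * (0 - 2 * (y - a) $ j)) = f1 j y"
        by (simp add: f1_def algebra_simps)
      ultimately show ?thesis by simp
    qed
    have f2: "has_partial j (f1 j) (f2 j y) y" if "y \<in> ball a R" for j y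
      unfolding f1_def f2_def using that
      by (intro has_partial_cmult has_partial_mult has_partial_powr s1 has_partial_nth) (simp add: spos)
    have fc: "continuous_on (ball a R) f"
      unfolding f_def s_def
      by (intro continuous_intros) (use spos in \<open>force simp: s_def\<close>)
    have f2c: "isCont (\<lambda>y. \<Sum>j\<in>UNIV. f2 j y) x"
      unfolding f2_def s_def
      by (intro continuous_intros) (use sx in \<open>auto simp: s_def\<close>)
    have xb: "x \<in> ball a R" using sx spos by simp
    have fx: "f x = z x" using sx by (simp add: f_def L_def powr_minus field_simps)
    have touch: "z y - f y \<le> z x - f x" if "y \<in> ball a R" for y
    proof -
      have "s y > 0" using that spos by simp
      moreover have "z y * s y powr k \<le> L" using xmax[of y] that unfolding L_def by auto
      ultimately have "z y \<le> f y" by (simp add: f_def powr_minus field_simps)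
      then show ?thesis using fx by simp
    qed
    have nz: "grad v x \<noteq> 0" using zx by (auto simp: z_def)
    have main: "2 * z x powr q \<le> (\<Sum>j\<in>UNIV. f2 j x)
      + M * q * z x powr (q / 2 - 1) * (\<Sum>i\<in>UNIV. partial_derivative i v x * f1 i x)"
      using gradient_touching[OF p q M C2 nonneg eqn open_ball xb nz fc f1 f2 f2c] touch
      unfolding z_def by blast
    define S where "S = s x"
    define w where "w = z x"
    have pos: "S > 0" "w > 0" using sx zx by (auto simp: S_def w_def)
    have lam1: "L * S powr (- k - 1) = w / S"
      using pos by (simp add: L_def S_def[symmetric] w_def[symmetric] powr_diff powr_minus field_simps)
    have lam2: "L * S powr (- k - 1 - 1) = w / S\<^sup>2"
      using pos by (simp add: L_def S_def[symmetric] w_def[symmetric] powr_diff powr_minus field_simps power2_eq_square)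
    have f1x: "f1 i x = 2 * k * (w / S) * (x - a) $ i" for i
      unfolding f1_def S_def[symmetric] lam1[symmetric] by (simp add: mult_ac)
    have f2x: "f2 i x = 4 * k * (k + 1) * (w / S\<^sup>2) * ((x - a) $ i * (x - a) $ i) + 2 * k * (w / S)" for i
      unfolding f2_def S_def[symmetric] lam1[symmetric] lam2[symmetric] by (simp add: algebra_simps)
    have sumsq: "(\<Sum>i\<in>UNIV. (x - a) $ i * (x - a) $ i) = (norm (x - a))\<^sup>2"
      by (simp add: power2_norm_eq_inner inner_vec_def)
    have "(\<Sum>j\<in>UNIV. f2 j x) = 4 * k * (k + 1) * (w / S\<^sup>2) * (norm (x - a))\<^sup>2 + n * (2 * k * (w / S))"
      unfolding f2x sum.distrib sum_distrib_left[symmetric] sumsq by (simp add: n_def)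
    (* S \<le> R^2 brings both terms to the common order w R^2 / S^2. *)
    also have "\<dots> \<le> 4 * k * (k + 1) * (w / S\<^sup>2) * R\<^sup>2 + n * (2 * k * (w / S\<^sup>2 * R\<^sup>2))"
    proof (intro add_mono mult_left_mono)
      show "(norm (x - a))\<^sup>2 \<le> R\<^sup>2" unfolding dist using pos by (simp add: S_def)
      have "S \<le> R\<^sup>2" using sR by (simp add: S_def)
      then have "w * S \<le> w * R\<^sup>2" using pos by simp
      then show "w / S \<le> w / S\<^sup>2 * R\<^sup>2" using pos by (simp add: field_simps power2_eq_square)
    qed (use k0 pos in \<open>auto simp: n_def\<close>)
    finally have lap: "(\<Sum>j\<in>UNIV. f2 j x) \<le> w * ((4 * k * (k + 1) + 2 * n * k) * (R / S)\<^sup>2)"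
      by (simp add: algebra_simps power_divide)
    have wh: "w powr (1 / 2) = norm (grad v x)"
      using pos by (simp add: w_def z_def powr_half_sqrt)
    have "(\<Sum>i\<in>UNIV. partial_derivative i v x * f1 i x) = 2 * k * (w / S) * (grad v x \<bullet> (x - a))"
      unfolding f1x inner_vec_def sum_distrib_left by (simp add: grad_def mult_ac)
    also have "\<dots> \<le> 2 * k * (w / S) * (w powr (1 / 2) * R)"
    proof (intro mult_left_mono)
      have "grad v x \<bullet> (x - a) \<le> norm (grad v x) * norm (x - a)"
        by (rule norm_cauchy_schwarz)
      also have "\<dots> \<le> norm (grad v x) * R"
        using xb by (intro mult_left_mono) (auto simp: dist_norm norm_minus_commute)
      finally show "grad v x \<bullet> (x - a) \<le> w powr (1 / 2) * R" unfolding wh .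
    qed (use k0 pos in auto)
    finally have D: "(\<Sum>i\<in>UNIV. partial_derivative i v x * f1 i x) \<le> 2 * k * (w / S) * (w powr (1 / 2) * R)" .
    define y where "y = w powr ((q - 1) / 2)"
    have y2: "w * y\<^sup>2 = w powr q"
    proof -
      have "y\<^sup>2 = w powr (q - 1)" by (simp add: y_def power2_eq_square flip: powr_add)
      then show ?thesis using pos by (simp add: powr_diff)
    qed
    have y1: "w powr (q / 2 - 1) * w powr (1 / 2) = y"
      unfolding y_def powr_add[symmetric] by (rule arg_cong[where f = "(powr) w"]) (simp add: field_simps)
    have "2 * (w * y\<^sup>2) \<le> w * ((4 * k * (k + 1) + 2 * n * k) * (R / S)\<^sup>2)
        + M * q * w powr (q / 2 - 1) * (2 * k * (w / S) * (w powr (1 / 2) * R))"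
      using main lap mult_left_mono[OF D, of "M * q * w powr (q / 2 - 1)"] M0 q1
      unfolding y2 w_def[symmetric] by simp
    also have "M * q * w powr (q / 2 - 1) * (2 * k * (w / S) * (w powr (1 / 2) * R))
        = w * (2 * (M * q * k) * y * (R / S))"
      unfolding y1[symmetric] by simp
    finally have "w * (2 * y\<^sup>2) \<le> w * ((4 * k * (k + 1) + 2 * n * k) * (R / S)\<^sup>2 + 2 * (M * q * k) * y * (R / S))"
      by (simp add: algebra_simps)
    then have ineq: "2 * y\<^sup>2 \<le> (4 * k * (k + 1) + 2 * n * k) * (R / S)\<^sup>2 + 2 * (M * q * k) * y * (R / S)"
      using pos by simp
    define t where "t = y * (S / R)"
    have yt: "y = t * (R / S)" using pos R by (simp add: t_def)
    have "2 * t\<^sup>2 \<le> 2 * (M * q * k) * t + (4 * k * (k + 1) + 2 * n * k)"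
    proof -
      have "(2 * t\<^sup>2) * (R / S)\<^sup>2 \<le> (2 * (M * q * k) * t + (4 * k * (k + 1) + 2 * n * k)) * (R / S)\<^sup>2"
        using ineq unfolding yt by (simp add: power2_eq_square algebra_simps)
      moreover have "(R / S)\<^sup>2 > 0" using pos R by simp
      ultimately show ?thesis by (rule mult_right_le_imp_le)
    qed
    then have "t \<le> B"
      unfolding B n_def by (rule quadratic_bound[OF _ MqK C0])
    then have "y * S \<le> R * B" using R by (simp add: t_def field_simps)
    have kk: "(q - 1) / 2 * k = 1" using q1 by (simp add: k)
    have "y powr k = w powr ((q - 1) / 2 * k)" by (simp only: y_def powr_powr)
    then have "y powr k = w" using kk pos by simp
    then have "L = (y * S) powr k"
      using pos by (simp add: L_def w_def[symmetric] S_def[symmetric] powr_mult y_def)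
    also have "\<dots> \<le> (R * B) powr k"
      using \<open>y * S \<le> R * B\<close> pos k0 by (intro powr_mono2) (auto simp: y_def)
    finally show ?thesis .
  qed
  moreover have "z a * (R\<^sup>2) powr k \<le> L"
    using xmax[of a] R unfolding L_def by (simp add: s_def)
  ultimately have "z a * (R\<^sup>2) powr k \<le> (R * B) powr k" by linarith
  then have "z a \<le> (R * B) powr k / (R\<^sup>2) powr k" using R by (simp add: field_simps)
  also have "\<dots> = (R * B / R\<^sup>2) powr k" using R B0 by (simp add: powr_divide)
  also have "R * B / R\<^sup>2 = B / R" using R by (simp add: power2_eq_square)
  finally show ?thesis by (simp add: z_def)
qed

section \<open>The Liouville theorem\<close>

lemma gradient_vanishes:
  fixes v :: "real ^ 'n::finite \<Rightarrow> real"
  assumes p: "p > 1" and q: "q = 2 * p / (p + 1)" and M: "M \<ge> real CARD('n) * (p + 1)"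
    and C2: "C2_function v" and nonneg: "\<And>y. v y \<ge> 0"
    and eqn: "\<And>y. laplacian v y + v y powr p + M * norm (grad v y) powr q = 0"
  shows "grad v a = 0"
proof -
  define k where "k = 2 / (q - 1)"
  define B where "B = 1 + M * q * k + (4 * k * (k + 1) + 2 * real CARD('n) * k)"
  have "q > 1" using p unfolding q by (simp add: field_simps)
  then have "k > 0" by (simp add: k_def)
  have "((\<lambda>R. B / R) \<longlongrightarrow> 0) at_top"
    by (rule tendsto_divide_0[OF tendsto_const filterlim_at_top_imp_at_infinity[OF filterlim_ident]])
  moreover have "B \<ge> 0"
  proof -
    have "M \<ge> 0" using M p by (smt (verit) mult_nonneg_nonneg of_nat_0_le_iff)
    then show ?thesis using \<open>k > 0\<close> \<open>q > 1\<close> by (simp add: B_def)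
  qed
  ultimately have lim: "((\<lambda>R. (B / R) powr k) \<longlongrightarrow> 0 powr k) at_top"
    using \<open>k > 0\<close> by (intro tendsto_powr' tendsto_const)
      (auto intro!: eventually_mono[OF eventually_gt_at_top[of 0]])
  have "(norm (grad v a))\<^sup>2 \<le> 0 powr k"
    by (rule tendsto_lowerbound[OF lim])
      (use gradient_estimate[OF p q M C2 nonneg eqn k_def B_def] in
        \<open>auto intro: eventually_mono[OF eventually_gt_at_top[of 0]]\<close>)
  then show ?thesis by simp
qed

theorem theorem1p6:
  fixes p q :: real
  assumes "CARD('n::finite) \<ge> 3"
    and "1 < p" and "p \<le> (real CARD('n) + 2) / (real CARD('n) - 2)"
    and "q = 2 * p / (p + 1)"
  shows "\<exists>M\<^sub>2::real. M\<^sub>2 > 0 \<and>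
    (\<forall>M::real. M > M\<^sub>2 \<longrightarrow>
      (\<forall>v :: real ^ 'n \<Rightarrow> real.
         C2_function v \<longrightarrow>
         (\<forall>x. v x \<ge> 0) \<longrightarrow>
         (\<forall>x. laplacian v x + v x powr p + M * norm (grad v x) powr q = 0) \<longrightarrow>
         (\<forall>x. v x = 0)))"
proof (intro exI[of _ "real CARD('n) * (p + 1)"] conjI allI impI)
  show "real CARD('n) * (p + 1) > 0" using assms(2) by simp
next
  fix M :: real and v :: "real ^ 'n \<Rightarrow> real" and x
  assume M: "M > real CARD('n) * (p + 1)" and C2: "C2_function v" and nonneg: "\<forall>x. v x \<ge> 0"
    and eqn: "\<forall>x. laplacian v x + v x powr p + M * norm (grad v x) powr q = 0"
  have grad0: "grad v y = 0" for y
    by (rule gradient_vanishes[OF assms(2,4) less_imp_le[OF M] C2]) (use nonneg eqn in auto)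
  then have "partial_derivative i v = (\<lambda>y. 0)" for i
    by (intro ext) (metis grad_def vec_lambda_beta zero_index)
  then have "laplacian v x = 0"
    by (simp add: laplacian_def partial_derivative_def)
  then have "v x powr p = 0" using spec[OF eqn, of x] grad0[of x] by simp
  then show "v x = 0" by simp
qed

end
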